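(* For every finite group $G$, the reduced power graph $\mathcal{P}_R(G)$ is a divisor graph.
   Context: The reduced power graph $\mathcal{P}_R(G)$ of a finite group $G$ is the undirected graph with vertex set $G$ in which two distinct vertices $x,y$ are adjacent if and only if $\langle x\rangle\subsetneq\langle y\rangle$ or $\langle y\rangle\subsetneq\langle x\rangle$ (proper containment). A simple undirected graph $\Gamma$ is a divisor graph if there is an injection $\alpha$ from $V(\Gamma)$ to the set of positive integers such that distinct $x,y\in V(\Gamma)$ are adjacent if and only if $\alpha(x)\mid\alpha(y)$ or $\alpha(y)\mid\alpha(x)$. *)

theory Defs
  imports "HOL-Algebra.Generated_Groups" "Graph_Theory.Pair_Digraph"
begin

text \<open>
  A simple undirected graph is a symmetric loop-free digraph without parallel arcs
  (\<^locale>\<open>pair_bidirected_digraph\<close>): an edge between \<open>x\<close> and \<open>y\<close> is the pair of arcs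
  \<open>(x, y)\<close> and \<open>(y, x)\<close>.
\<close>

definition reduced_power_graph :: "('a, 'b) monoid_scheme \<Rightarrow> 'a pair_pre_digraph" where
  "reduced_power_graph G =
    \<lparr> pverts = carrier G,
      parcs = {(x, y). x \<in> carrier G \<and> y \<in> carrier G \<and> x \<noteq> y \<and>
        (generate G {x} \<subset> generate G {y} \<or> generate G {y} \<subset> generate G {x})} \<rparr>"

definition divisor_graph :: "'a pair_pre_digraph \<Rightarrow> bool" where
  "divisor_graph \<Gamma> \<longleftrightarrow>
    pair_bidirected_digraph \<Gamma> \<and>
    (\<exists>\<alpha> :: 'a \<Rightarrow> nat.
      inj_on \<alpha> (pverts \<Gamma>) \<and> (\<forall>x \<in> pverts \<Gamma>. 0 < \<alpha> x) \<and>
      (\<forall>x \<in> pverts \<Gamma>. \<forall>y \<in> pverts \<Gamma>. x \<noteq> y \<longrightarrow>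
        ((x, y) \<in> parcs \<Gamma> \<longleftrightarrow> \<alpha> x dvd \<alpha> y \<or> \<alpha> y dvd \<alpha> x)))"

end

theory Submission
  imports Defs "HOL-Computational_Algebra.Primes"
begin

text \<open>
  Adjacency in the reduced power graph is comparability in the strict partial order
  \<open>\<langle>x\<rangle> \<subset> \<langle>y\<rangle>\<close> on the group elements, and the comparability graph of every finite strict
  partial order is a divisor graph. For the latter, attach a distinct prime \<open>p y\<close> to each element
  and label \<open>x\<close> by the product of the primes of the elements weakly below \<open>x\<close>. A label is then
  a square-free code of a principal down-set: divisibility of labels is inclusion of down-sets,
  and one principal down-set contains another exactly if it contains its top element.

  The order is taken strictly, on elements rather than on the subgroups they generate. Two
  generators of the same cyclic subgroup are therefore incomparable and receive different labels,
  neither dividing the other, as proper containment demands.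
\<close>

text \<open>
  Divisibility reflects the order because the prime attached to \<open>x\<close> divides the label of \<open>x\<close>,
  hence every multiple of it, while it divides the label of \<open>y\<close> only if \<open>x\<close> is weakly below
  \<open>y\<close>. Conversely, transitivity makes the down-sets grow along \<open>R\<close>. Irreflexivity together with
  transitivity gives antisymmetry, and with it injectivity.
\<close>

lemma finite_strict_order_divisibility_labelling:
  assumes fin: "finite V" and irrefl: "irreflp_on V R" and trans: "transp_on V R"
  obtains \<alpha> :: "'a \<Rightarrow> nat"
  where "\<And>x. 0 < \<alpha> x"
    and "\<And>x y. x \<in> V \<Longrightarrow> y \<in> V \<Longrightarrow> \<alpha> x dvd \<alpha> y \<longleftrightarrow> x = y \<or> R x y"
    and "inj_on \<alpha> V"
proof -
  obtain P :: "nat set" where P: "finite P" "card P = card V" "P \<subseteq> {q. prime q}"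
    using infinite_arbitrarily_large[OF primes_infinite] by blast
  obtain p where p: "bij_betw p V P"
    using finite_same_card_bij[OF fin P(1)] P(2) by auto
  have prime_p: "prime (p x)" if "x \<in> V" for x
    using that p P(3) by (auto dest: bij_betwE)
  have p_inj: "p x = p y \<longleftrightarrow> x = y" if "x \<in> V" "y \<in> V" for x y
    using that p by (auto simp: bij_betw_def dest: inj_onD)
  define down where "down x = {z \<in> V. z = x \<or> R z x}" for x
  define \<alpha> where "\<alpha> x = (\<Prod>z\<in>down x. p z)" for x
  have fin_down: "finite (down x)" for x
    using fin by (simp add: down_def)
  have pos: "0 < \<alpha> x" for x
    unfolding \<alpha>_def by (rule prod_pos) (auto simp: down_def intro: prime_gt_0_nat prime_p)
  have dvd_iff: "\<alpha> x dvd \<alpha> y \<longleftrightarrow> x = y \<or> R x y" if x: "x \<in> V" and y: "y \<in> V" for x y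
  proof
    assume "\<alpha> x dvd \<alpha> y"
    moreover have "p x dvd \<alpha> x"
      unfolding \<alpha>_def using fin_down x by (intro dvd_prodI) (auto simp: down_def)
    ultimately have "p x dvd (\<Prod>z\<in>down y. p z)"
      unfolding \<alpha>_def[of y, symmetric] by (rule dvd_trans[rotated])
    then obtain z where z: "z \<in> down y" "p x dvd p z"
      using prime_dvd_prod_iff[OF fin_down prime_p[OF x]] by blast
    then have "z \<in> V" by (simp add: down_def)
    then have "z = x"
      using z(2) primes_dvd_imp_eq[OF prime_p[OF x] prime_p] p_inj[OF x] by blast
    with z(1) show "x = y \<or> R x y" by (simp add: down_def)
  next
    assume "x = y \<or> R x y"
    then have "down x \<subseteq> down y"
      unfolding down_def using x y by (blast intro: transp_onD[OF trans])
    then show "\<alpha> x dvd \<alpha> y"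
      unfolding \<alpha>_def by (intro prod_dvd_prod_subset fin_down)
  qed
  have "inj_on \<alpha> V"
  proof (rule inj_onI)
    fix x y assume xy: "x \<in> V" "y \<in> V" "\<alpha> x = \<alpha> y"
    then have "x = y \<or> R x y" "x = y \<or> R y x"
      using dvd_iff[of x y] dvd_iff[of y x] by auto
    then show "x = y"
      using transp_onD[OF trans xy(1,2,1)] irreflp_onD[OF irrefl xy(1)] by blast
  qed
  with pos dvd_iff show thesis by (rule that)
qed

theorem corollary3p3:
  fixes G :: "('a, 'b) monoid_scheme"
  assumes "group G" and "finite (carrier G)"
  shows "divisor_graph (reduced_power_graph G)"
proof -
  define R where "R x y \<longleftrightarrow> generate G {x} \<subset> generate G {y}" for x y
  have "irreflp_on (carrier G) R" "transp_on (carrier G) R"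
    by (auto simp: R_def irreflp_on_def transp_on_def)
  with assms(2) obtain \<alpha> :: "'a \<Rightarrow> nat"
    where pos: "\<And>x. 0 < \<alpha> x"
      and dvd_iff: "\<And>x y. x \<in> carrier G \<Longrightarrow> y \<in> carrier G \<Longrightarrow> \<alpha> x dvd \<alpha> y \<longleftrightarrow> x = y \<or> R x y"
      and inj: "inj_on \<alpha> (carrier G)"
    by (rule finite_strict_order_divisibility_labelling) blast
  let ?\<Gamma> = "reduced_power_graph G"
  have verts: "pverts ?\<Gamma> = carrier G"
    by (simp add: reduced_power_graph_def)
  have arcs: "(x, y) \<in> parcs ?\<Gamma> \<longleftrightarrow>
      x \<in> carrier G \<and> y \<in> carrier G \<and> x \<noteq> y \<and> (R x y \<or> R y x)" for x y
    by (simp add: reduced_power_graph_def R_def)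
  have "sym (parcs ?\<Gamma>)"
    by (rule symI) (simp only: arcs, blast)
  then have "symmetric (with_proj ?\<Gamma>)"
    by (simp add: symmetric_def arcs_ends_def arc_to_ends_def)
  moreover have "pair_wf_digraph ?\<Gamma>"
    by unfold_locales (use arcs verts in \<open>force+\<close>)
  moreover have "fst e \<noteq> snd e" if "e \<in> parcs ?\<Gamma>" for e
    using that arcs[of "fst e" "snd e"] by simp
  ultimately have "pair_bidirected_digraph ?\<Gamma>"
    by (simp add: pair_bidirected_digraph_def pair_sym_digraph_def pair_sym_digraph_axioms_def
        pair_loopfree_digraph_def pair_loopfree_digraph_axioms_def)
  then show ?thesis
    unfolding divisor_graph_def verts using pos inj dvd_iff arcs
    by (intro conjI exI[of _ \<alpha>]) auto
qed

end
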